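(* Let $m,n,t>0$ be integers. (i) The number of small $(m,t)$-Schröder paths of height $n$ with exactly $a$-many diagonal steps and $b$-many cornered diagonal steps is $$\sum_{i=1}^{n-t+1}\left(\frac{(n-i)(mn-i+a+1)}{n(mn-i+a-b)}-\frac{n-t-i+1}{n-t+1}+\frac{(b+1)(m-1)}{mn-i+a-b}\right)\binom{mn-i+a-b}{a-b}\binom{n-t+1}{n-t-i+1}\binom{mn}{i-a-1}.$$ (ii) The number of $m$-divisible small $(m,t)$-Schröder paths of height $n$ with exactly $a$-many diagonal steps and $b$-many cornered diagonal steps is $$\sum_{i=1}^{n-t+1}\left(\frac{(n-i)(n-i+a+1)}{n(n-i+a-b)}-\frac{m(n-t-i+1)}{mn-t+1}\right)\binom{n-i+a-b}{a-b}\binom{mn-t+1}{n-t-i+1}\binom{n}{i-a-1}.$$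
   Context: A small $(m,t)$-Schröder path of height $n$ is a lattice path from $(0,0)$ to $(mn,n)$ with the following properties: it uses only steps of the form $N=(0,1)$ (north steps), $E=(1,0)$ (east steps) or $D=(1,1)$ (diagonal steps); it stays weakly above the line $x=my$ (every lattice point $(p,q)$ on it satisfies $p\le mq$); it starts with at least $t$ north steps; and it does not have a diagonal step starting on the line $x=my$. Such a path is $m$-divisible if every diagonal step ends at an $x$-coordinate divisible by $m$. A diagonal step is cornered if it connects coordinates of the form $(im-1,i)$ and $(im,i+1)$ for some $i\in\{1,\ldots,n\}$.
   Formalization: Where the printed summand has 0/0 (t=1, i=n, a=b; in (i) also m=1), the quotient (n-i)/(mn-i+a-b), resp. (n-i)/(n-i+a-b), is read as 1, and the term (b+1)(m-1)/(mn-i+a-b) as 0; if a<b, summands are 0 as the binomial over a-b is 0. *)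

theory Defs
  imports Complex_Main "HOL-Library.Product_Plus"
begin

datatype step = N | E | D

fun step_vec :: "step \<Rightarrow> int \<times> int" where
  "step_vec N = (0, 1)"
| "step_vec E = (1, 0)"
| "step_vec D = (1, 1)"

text \<open>A lattice path starting at the origin is its list of steps; \<open>vertex w k\<close> is the lattice
  point reached after the first \<open>k\<close> steps of \<open>w\<close>.\<close>

definition vertex :: "step list \<Rightarrow> nat \<Rightarrow> int \<times> int" where
  "vertex w k = sum_list (map step_vec (take k w))"

definition small_schroeder_path :: "nat \<Rightarrow> nat \<Rightarrow> nat \<Rightarrow> step list \<Rightarrow> bool" where
  "small_schroeder_path m t n w \<longleftrightarrow>
     vertex w (length w) = (int m * int n, int n) \<and>
     (\<forall>k\<le>length w. fst (vertex w k) \<le> int m * snd (vertex w k)) \<and>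
     take t w = replicate t N \<and>
     (\<forall>k<length w. w ! k = D \<longrightarrow> fst (vertex w k) \<noteq> int m * snd (vertex w k))"

definition divisible_path :: "nat \<Rightarrow> step list \<Rightarrow> bool" where
  "divisible_path m w \<longleftrightarrow>
     (\<forall>k<length w. w ! k = D \<longrightarrow> int m dvd fst (vertex w (Suc k)))"

definition diagonal_steps :: "step list \<Rightarrow> nat set" where
  "diagonal_steps w = {k. k < length w \<and> w ! k = D}"

definition cornered_steps :: "nat \<Rightarrow> nat \<Rightarrow> step list \<Rightarrow> nat set" where
  "cornered_steps m n w = {k \<in> diagonal_steps w. \<exists>i\<in>{1..int n}.
     vertex w k = (i * int m - 1, i) \<and> vertex w (Suc k) = (i * int m, i + 1)}"

text \<open>Binomial coefficient with integer arguments, equal to \<open>0\<close> when the lower argument is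
  negative.\<close>

definition zbinom :: "int \<Rightarrow> int \<Rightarrow> real" where
  "zbinom x k = (if k < 0 then 0 else real_of_int x gchoose nat k)"

text \<open>Division with \<open>0 / 0 = 1\<close>.  The closed formulas contain the quotients
  \<open>(n - i) / (m n - i + a - b)\<close> and \<open>(n - i) / (n - i + a - b)\<close>.  For \<open>t = 1\<close>, \<open>i = n\<close>, \<open>a = b\<close>
  (and \<open>m = 1\<close> in the first one) they read \<open>0 / 0\<close>; the formulas are then correct exactly when
  the common factor \<open>n - i\<close> is cancelled, i.e. when the quotient is taken to be \<open>1\<close>.\<close>

definition ratio :: "real \<Rightarrow> real \<Rightarrow> real" where
  "ratio x y = (if x = 0 \<and> y = 0 then 1 else x / y)"

end

theory Submission
  imports Defs
begin

text \<open>After the initial run, a path is a word of steps that starts at some level \<open>p - m q \<ge> 0\<close>, where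
  \<open>p\<close> and \<open>q\<close> are the horizontal and vertical distances left to the end point.  Conditioning on the
  first step gives a linear recurrence for the number of words with \<open>j\<close> plain and \<open>b\<close> cornered
  diagonals.  For the closed form, read a diagonal as a marked valley \<open>EN\<close>; this is possible exactly
  because no diagonal starts on the line, and cornered diagonals become marked valleys on the line.
  The summand with index \<open>i\<close> then counts the paths with \<open>c = i - a - 1\<close> unmarked valleys.  For free
  \<open>p\<close> and \<open>q\<close> it is a combination of products of binomials, which satisfies the recurrence refined
  by \<open>c\<close>; summing over \<open>c\<close>, the terms for an unmarked valley telescope.\<close>

subsection \<open>Paths by the distance to their end point\<close>

text \<open>\<open>ok\<close> restricts the horizontal distance to the end after a diagonal step: it encodes
  \<open>m\<close>-divisibility.\<close>

fun remaining_path :: "nat \<Rightarrow> (int \<Rightarrow> bool) \<Rightarrow> int \<Rightarrow> int \<Rightarrow> step list \<Rightarrow> bool" where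
  "remaining_path m ok p q [] \<longleftrightarrow> p = 0 \<and> q = 0"
| "remaining_path m ok p q (N # w) \<longleftrightarrow> remaining_path m ok p (q - 1) w"
| "remaining_path m ok p q (E # w) \<longleftrightarrow> int m * q < p \<and> remaining_path m ok (p - 1) q w"
| "remaining_path m ok p q (D # w) \<longleftrightarrow>
     int m * q < p \<and> ok (p - 1) \<and> remaining_path m ok (p - 1) (q - 1) w"

text \<open>A diagonal is cornered exactly if it starts one unit to the left of the line, that is,
  at level \<open>p - m q = 1\<close>.\<close>

fun corner_count :: "nat \<Rightarrow> int \<Rightarrow> int \<Rightarrow> step list \<Rightarrow> nat" where
  "corner_count m p q [] = 0"
| "corner_count m p q (N # w) = corner_count m p (q - 1) w"
| "corner_count m p q (E # w) = corner_count m (p - 1) q w"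
| "corner_count m p q (D # w) =
     (if p = int m * q + 1 then 1 else 0) + corner_count m (p - 1) (q - 1) w"

text \<open>Here \<open>j\<close> counts the plain and \<open>b\<close> the cornered diagonals. Both
  are integers so that \<open>j - 1\<close> and \<open>b - 1\<close> make sense in the recurrence
  without case distinctions.\<close>

definition remaining_paths ::
  "nat \<Rightarrow> (int \<Rightarrow> bool) \<Rightarrow> int \<Rightarrow> int \<Rightarrow> int \<Rightarrow> int \<Rightarrow> step list set" where
  "remaining_paths m ok p q j b = {w. remaining_path m ok p q w \<and>
     int (count_list w D) - int (corner_count m p q w) = j \<and> int (corner_count m p q w) = b}"

section \<open>Vertex conditions as guards on the remaining distances\<close>

lemma vertex_0 [simp]: "vertex w 0 = 0"
  by (simp add: vertex_def)

lemma vertex_Cons_Suc [simp]: "vertex (s # w) (Suc k) = step_vec s + vertex w k"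
  by (simp add: vertex_def)

lemma all_le_Suc: "(\<forall>k\<le>Suc n. P k) \<longleftrightarrow> P 0 \<and> (\<forall>k\<le>n. P (Suc k))"
  by (metis Suc_le_mono le0 not0_implies_Suc)

text \<open>Only east and diagonal steps can bring the path closer to the line, and their guards
  keep \<open>p - m q\<close> nonnegative. The assumption accounts for the vertex with index 0,
  which no guard inspects.\<close>

lemma remaining_path_iff:
  assumes "int m * q \<le> p"
  shows "remaining_path m ok p q w \<longleftrightarrow> vertex w (length w) = (p, q) \<and>
    (\<forall>k\<le>length w. int m * (q - snd (vertex w k)) \<le> p - fst (vertex w k)) \<and>
    (\<forall>k<length w. w ! k = D \<longrightarrow>
       int m * (q - snd (vertex w k)) \<noteq> p - fst (vertex w k) \<and> ok (p - fst (vertex w (Suc k))))"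
  using assms
proof (induction w arbitrary: p q)
  case Nil
  then show ?case by (auto simp: zero_prod_def)
next
  case (Cons s w)
  have eq: "x + vertex w k = (p, q) \<longleftrightarrow> vertex w k = (p - fst x, q - snd x)" for x k
    by (cases x; cases "vertex w k") auto
  show ?case
  proof (cases s)
    case N
    have *: "int m * (q - 1) \<le> p"
      using Cons.prems by (simp add: right_diff_distrib)
    show ?thesis
      using Cons.prems * unfolding N by (simp add: Cons.IH all_le_Suc All_less_Suc2 eq diff_diff_eq)
  next
    case E
    show ?thesis
    proof (cases "int m * q < p")
      case True
      then show ?thesis
        using Cons.prems unfolding E by (simp add: Cons.IH all_le_Suc All_less_Suc2 eq diff_diff_eq)
    next
      case False
      \<comment> \<open>Here the start lies on the line, so an east step leaves the region at vertex
        1.\<close>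
      have "\<not> int m * (q - snd (vertex (E # w) 1)) \<le> p - fst (vertex (E # w) 1)"
        using False by simp
      then show ?thesis using False unfolding E
        by (metis One_nat_def le_add1 length_Cons plus_1_eq_Suc remaining_path.simps(3))
    qed
  next
    case D
    have *: "int m * q < p \<Longrightarrow> int m * (q - 1) \<le> p - 1"
      using Cons.prems by (simp add: right_diff_distrib)
    show ?thesis
      using Cons.prems * unfolding D
      by (cases "int m * q = p")
        (simp_all add: Cons.IH all_le_Suc All_less_Suc2 eq diff_diff_eq, blast)
  qed
qed

lemma remaining_path_bounds:
  "remaining_path m ok p q w \<Longrightarrow> 0 \<le> p \<and> 0 \<le> q \<and> int (length w) \<le> p + q"
  by (induction m ok p q w rule: remaining_path.induct) auto

lemma finite_remaining_paths: "finite (remaining_paths m ok p q j b)"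
proof (rule finite_subset)
  have "(UNIV :: step set) = {N, E, D}"
    using step.exhaust by auto
  then have "finite (UNIV :: step set)"
    by (metis finite.emptyI finite.insertI)
  then show "finite {w. set w \<subseteq> (UNIV :: step set) \<and> length w \<le> nat (p + q)}"
    by (rule finite_lists_length_le)
  show "remaining_paths m ok p q j b \<subseteq> {w. set w \<subseteq> UNIV \<and> length w \<le> nat (p + q)}"
    using remaining_path_bounds by (fastforce simp: remaining_paths_def)
qed

lemma remaining_paths_outside: "q < 0 \<Longrightarrow> remaining_paths m ok p q j b = {}"
  using remaining_path_bounds by (fastforce simp: remaining_paths_def)

lemma corner_count_le: "corner_count m p q w \<le> count_list w D"
  by (induction m p q w rule: corner_count.induct) auto

lemma remaining_paths_neg:
  assumes "j < 0 \<or> b < 0"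
  shows "remaining_paths m ok p q j b = {}"
proof -
  have "\<not> (int (count_list w D) - int (corner_count m p q w) = j \<and> int (corner_count m p q w) = b)"
    for w
    using assms corner_count_le[of m p q w] by linarith
  then show ?thesis by (simp add: remaining_paths_def)
qed

text \<open>Split by the first step. A leading diagonal is charged to \<open>b\<close> if it starts
  at level 1 and to \<open>j\<close> otherwise.\<close>

lemma remaining_paths_rec:
  "remaining_paths m ok p q j b =
    (if p = 0 \<and> q = 0 \<and> j = 0 \<and> b = 0 then {[]} else {}) \<union>
    ((#) N ` remaining_paths m ok p (q - 1) j b \<union>
    ((#) E ` (if int m * q < p then remaining_paths m ok (p - 1) q j b else {}) \<union>
     (#) D ` (if int m * q < p \<and> ok (p - 1)
        then if p = int m * q + 1 then remaining_paths m ok (p - 1) (q - 1) j (b - 1)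
          else remaining_paths m ok (p - 1) (q - 1) (j - 1) b
        else {})))" (is "?L = ?R")
proof (rule set_eqI)
  fix w
  show "w \<in> ?L \<longleftrightarrow> w \<in> ?R"
  proof (cases w)
    case Nil
    then show ?thesis by (auto simp: remaining_paths_def)
  next
    case (Cons s w')
    then show ?thesis
      by (cases s) (auto simp: remaining_paths_def image_iff)
  qed
qed

subsection \<open>The recurrence for the number of paths\<close>

lemma card_remaining_paths_rec:
  "real (card (remaining_paths m ok p q j b)) =
    (if p = 0 \<and> q = 0 \<and> j = 0 \<and> b = 0 then 1 else 0) +
    real (card (remaining_paths m ok p (q - 1) j b)) +
    (if int m * q < p then real (card (remaining_paths m ok (p - 1) q j b)) else 0) +
    (if int m * q < p \<and> ok (p - 1)
        then if p = int m * q + 1 then real (card (remaining_paths m ok (p - 1) (q - 1) j (b - 1)))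
          else real (card (remaining_paths m ok (p - 1) (q - 1) (j - 1) b))
        else 0)"
proof -
  have fin: "finite ((#) s ` (remaining_paths m ok p' q' j' b'))" for s p' q' j' b'
    by (simp add: finite_remaining_paths)
  have card: "card ((#) s ` X) = card X" for s :: step and X
    by (rule card_image) simp
  show ?thesis
    by (subst remaining_paths_rec, subst card_Un_disjoint,
        (force simp: fin)+, subst card_Un_disjoint, (force simp: fin)+,
        subst card_Un_disjoint, (force simp: fin)+, simp add: card)
qed

text \<open>Shifting the number of unmarked valleys by one changes the sum by boundary terms
  only.\<close>

lemma sum_shift_diff:
  fixes f :: "int \<Rightarrow> real"
  assumes "0 \<le> M" shows "(\<Sum>c=0..M. f (c - 1)) = (\<Sum>c=0..M. f c) + f (-1) - f M"
proof -
  have "(\<Sum>c=0..M. f (c - 1)) = sum f {-1..M - 1}"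
    by (rule sum.reindex_bij_witness[of _ "\<lambda>c. c + 1" "\<lambda>c. c - 1"]) auto
  also have "\<dots> = sum f {-1..M} - f M"
  proof -
    have "{-1..M} = insert M {-1..M - 1}" using assms by auto
    then show ?thesis by simp
  qed
  also have "sum f {-1..M} = f (-1) + sum f {0..M}"
  proof -
    have "{-1..M} = insert (-1) {0..M}" using assms by auto
    then show ?thesis by simp
  qed
  finally show ?thesis by simp
qed

text \<open>\<open>step\<close> is the recurrence with the path after an east step split according to
  whether a north step follows; the term with \<open>c - 1\<close> is an unmarked valley.  In \<open>corner\<close>, that east step
  reaches the line, so a north step has to follow.\<close>

lemma card_remaining_paths_eq_sum:
  fixes T :: "int \<Rightarrow> int \<Rightarrow> int \<Rightarrow> int \<Rightarrow> int \<Rightarrow> real"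
  assumes m: "m > 0" and ok: "\<And>q. ok (int m * q)"
    and base: "\<And>p c j b. 0 \<le> c \<Longrightarrow> 0 \<le> j \<Longrightarrow> 0 \<le> b \<Longrightarrow>
      T p 0 c j b = (if c = 0 \<and> j = 0 \<and> b = 0 then 1 else 0)"
    and vanish: "\<And>p q c j b. c < 0 \<or> j < 0 \<or> q < c \<Longrightarrow> 0 \<le> q \<Longrightarrow> 0 \<le> b \<Longrightarrow>
      T p q c j b = 0"
    and step: "\<And>p q c j b. ok (p - 1) \<Longrightarrow>
      T p q c j b + T (p - 1) (q - 1) c j b = T p (q - 1) c j b + T (p - 1) q c j b
        + T (p - 1) (q - 1) c (j - 1) b + T (p - 1) (q - 1) (c - 1) j b"
    and step': "\<And>p q c j b. \<not> ok (p - 1) \<Longrightarrow>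
      T p q c j b = T p (q - 1) c j b + T (p - 1) q c j b"
    and corner: "\<And>q c j b. 0 < q \<Longrightarrow> 0 \<le> b \<Longrightarrow> T (int m * q + 1) q c j b =
      T (int m * q + 1) (q - 1) c j b + T (int m * q) (q - 1) (c - 1) j b
        + (if b = 0 then 0 else T (int m * q) (q - 1) c j (b - 1))"
  shows "int m * q < p \<Longrightarrow> 0 \<le> q \<Longrightarrow> q \<le> M \<Longrightarrow> 0 \<le> b \<Longrightarrow>
    real (card (remaining_paths m ok p q j b)) = (\<Sum>c=0..M. T p q c j b)"
proof (induction "nat (p + q)" arbitrary: p q j b rule: less_induct)
  case less
  let ?C = "\<lambda>p q j b. real (card (remaining_paths m ok p q j b))"
  let ?S = "\<lambda>p q j b. \<Sum>c=0..M. T p q c j b"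
  have M: "0 \<le> M" using less.prems by simp
  have p: "0 < p" using less.prems m by (smt (verit) mult_nonneg_nonneg of_nat_0_le_iff)
  have IH: "?C p' q' j' b' = ?S p' q' j' b'"
    if "p' \<le> p" "q' \<le> q" "p' < p \<or> q' < q" "int m * q' < p'" "0 \<le> q'" "0 \<le> b'" for p' q' j' b'
  proof (rule less.hyps)
    have "0 \<le> p'" using that m by (smt (verit) mult_nonneg_nonneg of_nat_0_le_iff)
    then show "nat (p' + q') < nat (p + q)" using that by linarith
  qed (use that less.prems in auto)
  show ?case
  proof (cases "j < 0")
    case True
    then show ?thesis using less.prems by (simp add: remaining_paths_neg vanish)
  next
    case False
    show ?thesis
    proof (cases "q = 0")
      case True
      \<comment> \<open>With no height left, only east steps remain, so there is exactly one path,
        without diagonals.\<close>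
      have S: "?S p' 0 j b = (if j = 0 \<and> b = 0 then 1 else 0)" for p'
      proof -
        have "?S p' 0 j b = (\<Sum>c=0..M. if c = 0 then (if j = 0 \<and> b = 0 then 1 else 0) else 0)"
          using False less.prems by (intro sum.cong) (auto simp: base)
        then show ?thesis using M by simp
      qed
      have "?C p 0 j b = ?C (p - 1) 0 j b"
        by (subst card_remaining_paths_rec) (use p in \<open>simp add: remaining_paths_outside\<close>)
      also have "\<dots> = (if j = 0 \<and> b = 0 then 1 else 0)"
      \<comment> \<open>For \<open>p = 1\<close> the east step ends on the line, where the induction
        hypothesis does not apply.\<close>
      proof (cases "p = 1")
        case True
        then show ?thesis
          by (subst card_remaining_paths_rec) (simp add: remaining_paths_outside)
      next
        case False
        then have "?C (p - 1) 0 j b = ?S (p - 1) 0 j b"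
          using p True less.prems by (intro IH) auto
        then show ?thesis using S by simp
      qed
      finally show ?thesis using S True by simp
    next
      case q0: False
      then have q: "0 < q" using less.prems by simp
      have mq: "int m * (q - 1) < int m * q" using m by simp
      have bN: "?C p (q - 1) j b = ?S p (q - 1) j b"
        using q mq less.prems by (intro IH) auto
      \<comment> \<open>Both boundary terms vanish: one has \<open>c = -1\<close>, the other has
        \<open>c = M > q - 1\<close>.\<close>
      have tele: "(\<Sum>c=0..M. T (p - 1) (q - 1) (c - 1) j b) = ?S (p - 1) (q - 1) j b"
        using sum_shift_diff[OF M, of "\<lambda>c. T (p - 1) (q - 1) c j b"] less.prems q
        by (simp add: vanish)
      show ?thesis
      proof (cases "p = int m * q + 1")
        case True
        \<comment> \<open>On the line only a north step is possible; after it the path is strictly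
          above the line again, as the induction hypothesis requires.\<close>
        have "?C (p - 1) q j b = ?C (p - 1) (q - 1) j b"
          by (subst card_remaining_paths_rec) (use True q in simp)
        also have "\<dots> = ?S (p - 1) (q - 1) j b"
          using q mq less.prems True by (intro IH) auto
        finally have bE: "?C (p - 1) q j b = ?S (p - 1) (q - 1) j b" .
        have bD: "?C (p - 1) (q - 1) j (b - 1) = (if b = 0 then 0 else ?S (p - 1) (q - 1) j (b - 1))"
        proof (cases "b = 0")
          case False
          then have "?C (p - 1) (q - 1) j (b - 1) = ?S (p - 1) (q - 1) j (b - 1)"
            using q mq less.prems True by (intro IH) auto
          then show ?thesis using False by simp
        qed (simp add: remaining_paths_neg)
        have "?C p q j b = ?C p (q - 1) j b + ?C (p - 1) q j b + ?C (p - 1) (q - 1) j (b - 1)"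
          by (subst card_remaining_paths_rec) (use True q ok in simp)
        also have "\<dots> = ?S p (q - 1) j b + (\<Sum>c=0..M. T (p - 1) (q - 1) (c - 1) j b)
            + (if b = 0 then 0 else ?S (p - 1) (q - 1) j (b - 1))"
          by (simp only: bN bE bD tele)
        also have "\<dots> = ?S p q j b"
          using corner[OF q \<open>0 \<le> b\<close>] True by (simp add: sum.distrib)
        finally show ?thesis .
      next
        case False
        then have L: "int m * q < p - 1" using less.prems by simp
        have bE: "?C (p - 1) q j b = ?S (p - 1) q j b"
          using q L less.prems by (intro IH) auto
        have bD: "?C (p - 1) (q - 1) (j - 1) b = ?S (p - 1) (q - 1) (j - 1) b"
          using q mq L less.prems by (intro IH) auto
        have rec: "?C p q j b = ?C p (q - 1) j b + ?C (p - 1) q j b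
            + (if ok (p - 1) then ?C (p - 1) (q - 1) (j - 1) b else 0)"
          by (subst card_remaining_paths_rec) (use False L q in simp)
        show ?thesis
        proof (cases "ok (p - 1)")
          case True
          \<comment> \<open>After summation the term with \<open>c - 1\<close> equals the extra term
            on the left by \<open>tele\<close>; what remains is the recurrence for the
            paths.\<close>
          have "(\<Sum>c=0..M. T p q c j b + T (p - 1) (q - 1) c j b) =
              (\<Sum>c=0..M. T p (q - 1) c j b + T (p - 1) q c j b
              + T (p - 1) (q - 1) c (j - 1) b + T (p - 1) (q - 1) (c - 1) j b)"
            using step[OF True] by simp
          then show ?thesis
            using rec True bN bE bD tele by (simp add: sum.distrib)
        next
          case False
          then show ?thesis
            using rec False bN bE by (simp add: step'[OF False, of q _ j b] sum.distrib)
        qed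
      qed
    qed
  qed
qed


subsection \<open>Closed forms satisfying the recurrence\<close>

lemma zbinom_neg: "k < 0 \<Longrightarrow> zbinom x k = 0"
  by (simp add: zbinom_def)

lemma zbinom_0 [simp]: "zbinom x 0 = 1"
  by (simp add: zbinom_def)

lemma zbinom_of_nat: "zbinom (int n) (int k) = real (n choose k)"
  by (simp add: zbinom_def binomial_gbinomial)

text \<open>Nonnegativity of \<open>x\<close> matters: generalized binomials such as
  \<open>zbinom (-1) k\<close> with \<open>0 \<le> k\<close> are not zero.\<close>

lemma zbinom_eq_0: "0 \<le> x \<Longrightarrow> x < k \<Longrightarrow> zbinom x k = 0"
  using zbinom_of_nat[of "nat x" "nat k"] by simp

lemma zbinom_Suc:
  "zbinom x (int l + 1) = real_of_int x gchoose Suc l"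
  "zbinom x (int l) = real_of_int x gchoose l"
  by (simp_all add: zbinom_def nat_add_distrib)

lemma zbinom_pascal: "zbinom (x + 1) k = zbinom x k + zbinom x (k - 1)"
proof (cases "k \<le> 0")
  case True
  then show ?thesis by (cases "k = 0") (simp_all add: zbinom_neg)
next
  case False
  then obtain l where k: "k = int l + 1"
    using that[of "nat (k - 1)"] by simp
  show ?thesis
    using gbinomial_Suc_Suc[of "real_of_int x" l] unfolding k zbinom_Suc
    by (simp add: zbinom_Suc add.commute)
qed

lemma zbinom_absorb: "of_int k * zbinom x k = of_int x * zbinom (x - 1) (k - 1)"
proof (cases "k \<le> 0")
  case True
  then show ?thesis by (cases "k = 0") (simp_all add: zbinom_neg)
next
  case False
  then obtain l where k: "k = int l + 1"
    using that[of "nat (k - 1)"] by simp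
  show ?thesis
    using gbinomial_absorption[of l "real_of_int x"] unfolding k zbinom_Suc
    by (simp add: zbinom_Suc add.commute)
qed

text \<open>Expand \<open>x * zbinom x k\<close> by Pascal's rule and subtract the absorption
  identity.\<close>

lemma zbinom_absorb_comp: "of_int (x - k) * zbinom x k = of_int x * zbinom (x - 1) k"
  using zbinom_absorb[of k x] zbinom_pascal[of "x - 1" k] by (simp add: algebra_simps)

text \<open>The number of paths with \<open>c\<close> unmarked valleys, \<open>j\<close> marked valleys off the line and
  \<open>b\<close> marked valleys on it, from any start strictly above the line.\<close>

definition path_term :: "nat \<Rightarrow> int \<Rightarrow> int \<Rightarrow> int \<Rightarrow> int \<Rightarrow> int \<Rightarrow> real" where
  "path_term m p q c j b =
     zbinom q (c + j + b) * zbinom p c * zbinom (p - c - b - 1) j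
     - real m * zbinom (q + 1) (c + j + b + 1)
       * (zbinom (p - 1) (c - 1) * zbinom (p - c - b - 1) j
          + zbinom (p - 1) c * zbinom (p - c - b - 2) (j - 1))"

lemma zbinom_pascal': "zbinom x k = zbinom (x - 1) k + zbinom (x - 1) (k - 1)"
  using zbinom_pascal[of "x - 1" k] by simp

text \<open>Pascal's rule in \<open>p\<close>, in \<open>q\<close> and in the factor for
  \<open>j\<close> reduces both sides to the same products. No relation between \<open>p\<close> and
  \<open>q\<close> enters.\<close>

lemma path_term_step:
  "path_term m p q c j b + path_term m (p - 1) (q - 1) c j b =
   path_term m p (q - 1) c j b + path_term m (p - 1) q c j b
     + path_term m (p - 1) (q - 1) c (j - 1) b + path_term m (p - 1) (q - 1) (c - 1) j b"
proof -
  \<comment> \<open>The number of all valleys; lowering \<open>c\<close> or \<open>j\<close> by one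
    lowers it by one.\<close>
  define v where "v = c + j + b"
  have q: "zbinom q v = zbinom (q - 1) v + zbinom (q - 1) (v - 1)"
    "zbinom (q + 1) (v + 1) = zbinom q (v + 1) + zbinom q v"
    using zbinom_pascal'[of q v] zbinom_pascal[of q "v + 1"] by (simp_all add: algebra_simps)
  have p: "zbinom p c = zbinom (p - 1) c + zbinom (p - 1) (c - 1)"
    "zbinom (p - 1) c = zbinom (p - 2) c + zbinom (p - 2) (c - 1)"
    "zbinom (p - 1) (c - 1) = zbinom (p - 2) (c - 1) + zbinom (p - 2) (c - 2)"
    using zbinom_pascal'[of p c] zbinom_pascal'[of "p - 1" c] zbinom_pascal'[of "p - 1" "c - 1"]
    by (simp_all add: algebra_simps)
  have j: "zbinom (p - c - b - 1) j = zbinom (p - c - b - 2) j + zbinom (p - c - b - 2) (j - 1)"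
    "zbinom (p - c - b - 2) (j - 1) = zbinom (p - c - b - 3) (j - 1) + zbinom (p - c - b - 3) (j - 2)"
    using zbinom_pascal'[of "p - c - b - 1" j] zbinom_pascal'[of "p - c - b - 2" "j - 1"]
    by (simp_all add: algebra_simps)
  have t1: "path_term m p q c j b = zbinom q v * zbinom p c * zbinom (p - c - b - 1) j
     - real m * zbinom (q + 1) (v + 1)
       * (zbinom (p - 1) (c - 1) * zbinom (p - c - b - 1) j
          + zbinom (p - 1) c * zbinom (p - c - b - 2) (j - 1))"
    by (simp add: path_term_def v_def)
  have t2: "path_term m (p - 1) (q - 1) c j b =
     zbinom (q - 1) v * zbinom (p - 1) c * zbinom (p - c - b - 2) j
     - real m * zbinom q (v + 1)
       * (zbinom (p - 2) (c - 1) * zbinom (p - c - b - 2) j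
          + zbinom (p - 2) c * zbinom (p - c - b - 3) (j - 1))"
    by (simp add: path_term_def v_def algebra_simps)
  have t3: "path_term m p (q - 1) c j b = zbinom (q - 1) v * zbinom p c * zbinom (p - c - b - 1) j
     - real m * zbinom q (v + 1)
       * (zbinom (p - 1) (c - 1) * zbinom (p - c - b - 1) j
          + zbinom (p - 1) c * zbinom (p - c - b - 2) (j - 1))"
    by (simp add: path_term_def v_def)
  have t4: "path_term m (p - 1) q c j b =
     zbinom q v * zbinom (p - 1) c * zbinom (p - c - b - 2) j
     - real m * zbinom (q + 1) (v + 1)
       * (zbinom (p - 2) (c - 1) * zbinom (p - c - b - 2) j
          + zbinom (p - 2) c * zbinom (p - c - b - 3) (j - 1))"
    by (simp add: path_term_def v_def algebra_simps)
  have t5: "path_term m (p - 1) (q - 1) c (j - 1) b =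
     zbinom (q - 1) (v - 1) * zbinom (p - 1) c * zbinom (p - c - b - 2) (j - 1)
     - real m * zbinom q v
       * (zbinom (p - 2) (c - 1) * zbinom (p - c - b - 2) (j - 1)
          + zbinom (p - 2) c * zbinom (p - c - b - 3) (j - 2))"
    by (simp add: path_term_def v_def algebra_simps)
  have t6: "path_term m (p - 1) (q - 1) (c - 1) j b =
     zbinom (q - 1) (v - 1) * zbinom (p - 1) (c - 1) * zbinom (p - c - b - 1) j
     - real m * zbinom q v
       * (zbinom (p - 2) (c - 2) * zbinom (p - c - b - 1) j
          + zbinom (p - 2) (c - 1) * zbinom (p - c - b - 2) (j - 1))"
    by (simp add: path_term_def v_def algebra_simps)
  show ?thesis
    unfolding t1 t2 t3 t4 t5 t6 q p j by (simp add: algebra_simps)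
qed

text \<open>Subtract the general recurrence at \<open>p = m q + 1\<close>. What remains to show
  concerns a start on the line: the combination in \<open>diff\<close> is the cornered term for
  \<open>b > 0\<close> and zero for \<open>b = 0\<close>.\<close>

lemma path_term_corner:
  assumes m: "m > 0" and q: "0 < q"
  shows "path_term m (int m * q + 1) q c j b =
      path_term m (int m * q + 1) (q - 1) c j b + path_term m (int m * q) (q - 1) (c - 1) j b
        + (if b = 0 then 0 else path_term m (int m * q) (q - 1) c j (b - 1))"
proof -
  define p where "p = int m * q"
  define v where "v = c + j + b"
  have step: "path_term m (p + 1) q c j b + path_term m p (q - 1) c j b =
   path_term m (p + 1) (q - 1) c j b + path_term m p q c j b
     + path_term m p (q - 1) c (j - 1) b + path_term m p (q - 1) (c - 1) j b"
    using path_term_step[of m "p + 1" q c j b] by simp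
  have qv: "zbinom q v = zbinom (q - 1) v + zbinom (q - 1) (v - 1)"
    "zbinom (q + 1) (v + 1) = zbinom q (v + 1) + zbinom q v"
    using zbinom_pascal'[of q v] zbinom_pascal[of q "v + 1"] by (simp_all add: algebra_simps)
  have j: "zbinom (p - c - b) j = zbinom (p - c - b - 1) j + zbinom (p - c - b - 1) (j - 1)"
    "zbinom (p - c - b - 1) (j - 1) = zbinom (p - c - b - 2) (j - 1) + zbinom (p - c - b - 2) (j - 2)"
    using zbinom_pascal'[of "p - c - b" j] zbinom_pascal'[of "p - c - b - 1" "j - 1"]
    by (simp_all add: algebra_simps)
  have t1: "path_term m p q c j b = zbinom q v * zbinom p c * zbinom (p - c - b - 1) j
     - real m * zbinom (q + 1) (v + 1)
       * (zbinom (p - 1) (c - 1) * zbinom (p - c - b - 1) j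
          + zbinom (p - 1) c * zbinom (p - c - b - 2) (j - 1))"
    by (simp add: path_term_def v_def)
  have t2: "path_term m p (q - 1) c j b = zbinom (q - 1) v * zbinom p c * zbinom (p - c - b - 1) j
     - real m * zbinom q (v + 1)
       * (zbinom (p - 1) (c - 1) * zbinom (p - c - b - 1) j
          + zbinom (p - 1) c * zbinom (p - c - b - 2) (j - 1))"
    by (simp add: path_term_def v_def)
  have t3: "path_term m p (q - 1) c (j - 1) b =
     zbinom (q - 1) (v - 1) * zbinom p c * zbinom (p - c - b - 1) (j - 1)
     - real m * zbinom q v
       * (zbinom (p - 1) (c - 1) * zbinom (p - c - b - 1) (j - 1)
          + zbinom (p - 1) c * zbinom (p - c - b - 2) (j - 2))"
    by (simp add: path_term_def v_def algebra_simps)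
  have diff: "path_term m p q c j b - path_term m p (q - 1) c j b + path_term m p (q - 1) c (j - 1) b
     = zbinom (q - 1) (v - 1) * zbinom p c * zbinom (p - c - b) j
     - real m * zbinom q v * (zbinom (p - 1) (c - 1) * zbinom (p - c - b) j
          + zbinom (p - 1) c * zbinom (p - c - b - 1) (j - 1))"
    unfolding t1 t2 t3 qv j by (simp add: algebra_simps)
  \<comment> \<open>For \<open>b > 0\<close> the identity holds for every \<open>p\<close>; only \<open>b = 0\<close> uses \<open>p = m q\<close>.\<close>
  show ?thesis
  proof (cases "b = 0")
    case False
    have "path_term m p (q - 1) c j (b - 1) =
       zbinom (q - 1) (v - 1) * zbinom p c * zbinom (p - c - b) j
       - real m * zbinom q v * (zbinom (p - 1) (c - 1) * zbinom (p - c - b) j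
          + zbinom (p - 1) c * zbinom (p - c - b - 1) (j - 1))"
      by (simp add: path_term_def v_def algebra_simps)
    then show ?thesis
      using False step diff unfolding p_def[symmetric] by simp
  next
    case True
    define X where "X = zbinom p c * zbinom (p - c) j"
    have c: "of_int p * zbinom (p - 1) (c - 1) = of_int c * zbinom p c"
      using zbinom_absorb[of c p] by simp
    have "of_int p * zbinom (p - 1) c = of_int (p - c) * zbinom p c"
      using zbinom_absorb_comp[of p c] by simp
    moreover have "of_int (p - c) * zbinom (p - c - 1) (j - 1) = of_int j * zbinom (p - c) j"
      using zbinom_absorb[of j "p - c"] by simp
    ultimately have d: "of_int p * (zbinom (p - 1) c * zbinom (p - c - 1) (j - 1)) = of_int j * X"
      unfolding X_def by algebra
    have v: "of_int q * zbinom (q - 1) (v - 1) = of_int v * zbinom q v"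
      using zbinom_absorb[of v q] by simp
    have p: "real_of_int p = real m * of_int q"
      by (simp add: p_def)
    \<comment> \<open>After multiplication by \<open>p\<close>, absorption turns every product into
      a multiple of \<open>X\<close>. Then \<open>c + j = v\<close> and \<open>p = m q\<close> make
      the two sides agree, and the factor \<open>p > 0\<close> cancels.\<close>
    have "real_of_int p * (real m * zbinom q v * (zbinom (p - 1) (c - 1) * zbinom (p - c) j
          + zbinom (p - 1) c * zbinom (p - c - 1) (j - 1))) =
        real m * zbinom q v * (of_int c * X + of_int j * X)"
      using c d unfolding X_def by algebra
    also have "\<dots> = real m * (of_int v * zbinom q v) * X"
      using True by (simp add: v_def algebra_simps)
    also have "\<dots> = real_of_int p * (zbinom (q - 1) (v - 1) * X)"
      unfolding v[symmetric] p by simp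
    finally have "real m * zbinom q v * (zbinom (p - 1) (c - 1) * zbinom (p - c) j
          + zbinom (p - 1) c * zbinom (p - c - 1) (j - 1)) = zbinom (q - 1) (v - 1) * X"
      using m q by (simp add: p_def)
    then show ?thesis
      using True step diff unfolding p_def[symmetric] X_def by simp
  qed
qed

text \<open>The analogue for \<open>m\<close>-divisible diagonals, with \<open>u = (p - 1) div m + 1\<close>: only valleys in the
  \<open>u - 1\<close> columns strictly ahead whose distance to the end is a positive multiple of \<open>m\<close> can be
  marked, and \<open>c\<close> counts the unmarked ones among these.\<close>

definition divisible_term :: "nat \<Rightarrow> int \<Rightarrow> int \<Rightarrow> int \<Rightarrow> int \<Rightarrow> int \<Rightarrow> int \<Rightarrow> real" where
  "divisible_term m u p q c j b =
     zbinom (u - 1) c * zbinom (u - c - b - 2) j * zbinom (p - u + q + 1) (q - c - j - b)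
     - real m * zbinom u c * zbinom (u - c - b - 1) j * zbinom (p - u + q) (q - c - j - b - 1)"

text \<open>While \<open>u\<close> is fixed, \<open>p\<close> and \<open>q\<close> occur only in the
  last factor of each product, where Pascal's rule gives the claim. This covers the columns in which
  no valley can be marked.\<close>

lemma divisible_term_pascal:
  "divisible_term m u p q c j b =
   divisible_term m u p (q - 1) c j b + divisible_term m u (p - 1) q c j b"
proof -
  define w k where "w = p - u + q" and "k = q - c - j - b"
  have w: "zbinom (w + 1) k = zbinom w k + zbinom w (k - 1)"
    "zbinom w (k - 1) = zbinom (w - 1) (k - 1) + zbinom (w - 1) (k - 2)"
    using zbinom_pascal[of w k] zbinom_pascal'[of w "k - 1"] by (simp_all add: algebra_simps)
  have t1: "divisible_term m u p q c j b =
     zbinom (u - 1) c * zbinom (u - c - b - 2) j * zbinom (w + 1) k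
     - real m * zbinom u c * zbinom (u - c - b - 1) j * zbinom w (k - 1)"
    by (simp add: divisible_term_def w_def k_def)
  have t2: "divisible_term m u p (q - 1) c j b =
     zbinom (u - 1) c * zbinom (u - c - b - 2) j * zbinom w (k - 1)
     - real m * zbinom u c * zbinom (u - c - b - 1) j * zbinom (w - 1) (k - 2)"
    by (simp add: divisible_term_def w_def k_def algebra_simps)
  have t3: "divisible_term m u (p - 1) q c j b =
     zbinom (u - 1) c * zbinom (u - c - b - 2) j * zbinom w k
     - real m * zbinom u c * zbinom (u - c - b - 1) j * zbinom (w - 1) (k - 1)"
    by (simp add: divisible_term_def w_def k_def algebra_simps)
  show ?thesis unfolding t1 t2 t3 w by (simp add: algebra_simps)
qed

text \<open>At a column that can carry a marked valley, \<open>u\<close> drops together with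
  \<open>p\<close>, so \<open>p - u\<close> is unchanged and Pascal's rule in \<open>u\<close> and
  \<open>q\<close> suffices.\<close>

lemma divisible_term_step:
  "divisible_term m u p q c j b + divisible_term m (u - 1) (p - 1) (q - 1) c j b =
   divisible_term m u p (q - 1) c j b + divisible_term m (u - 1) (p - 1) q c j b
     + divisible_term m (u - 1) (p - 1) (q - 1) c (j - 1) b
     + divisible_term m (u - 1) (p - 1) (q - 1) (c - 1) j b"
proof -
  define w k where "w = p - u + q" and "k = q - c - j - b"
  have w: "zbinom (w + 1) k = zbinom w k + zbinom w (k - 1)"
    "zbinom w (k - 1) = zbinom (w - 1) (k - 1) + zbinom (w - 1) (k - 2)"
    using zbinom_pascal[of w k] zbinom_pascal'[of w "k - 1"] by (simp_all add: algebra_simps)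
  have u: "zbinom u c = zbinom (u - 1) c + zbinom (u - 1) (c - 1)"
    "zbinom (u - 1) c = zbinom (u - 2) c + zbinom (u - 2) (c - 1)"
    using zbinom_pascal'[of u c] zbinom_pascal'[of "u - 1" c] by (simp_all add: algebra_simps)
  have j: "zbinom (u - c - b - 1) j = zbinom (u - c - b - 2) j + zbinom (u - c - b - 2) (j - 1)"
    "zbinom (u - c - b - 2) j = zbinom (u - c - b - 3) j + zbinom (u - c - b - 3) (j - 1)"
    using zbinom_pascal'[of "u - c - b - 1" j] zbinom_pascal'[of "u - c - b - 2" j]
    by (simp_all add: algebra_simps)
  have t1: "divisible_term m u p q c j b =
     zbinom (u - 1) c * zbinom (u - c - b - 2) j * zbinom (w + 1) k
     - real m * zbinom u c * zbinom (u - c - b - 1) j * zbinom w (k - 1)"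
    by (simp add: divisible_term_def w_def k_def)
  have t2: "divisible_term m u p (q - 1) c j b =
     zbinom (u - 1) c * zbinom (u - c - b - 2) j * zbinom w (k - 1)
     - real m * zbinom u c * zbinom (u - c - b - 1) j * zbinom (w - 1) (k - 2)"
    by (simp add: divisible_term_def w_def k_def algebra_simps)
  have t3: "divisible_term m (u - 1) (p - 1) q c j b =
     zbinom (u - 2) c * zbinom (u - c - b - 3) j * zbinom (w + 1) k
     - real m * zbinom (u - 1) c * zbinom (u - c - b - 2) j * zbinom w (k - 1)"
    by (simp add: divisible_term_def w_def k_def algebra_simps)
  have t4: "divisible_term m (u - 1) (p - 1) (q - 1) c j b =
     zbinom (u - 2) c * zbinom (u - c - b - 3) j * zbinom w (k - 1)
     - real m * zbinom (u - 1) c * zbinom (u - c - b - 2) j * zbinom (w - 1) (k - 2)"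
    by (simp add: divisible_term_def w_def k_def algebra_simps)
  have t5: "divisible_term m (u - 1) (p - 1) (q - 1) c (j - 1) b =
     zbinom (u - 2) c * zbinom (u - c - b - 3) (j - 1) * zbinom w k
     - real m * zbinom (u - 1) c * zbinom (u - c - b - 2) (j - 1) * zbinom (w - 1) (k - 1)"
    by (simp add: divisible_term_def w_def k_def algebra_simps)
  have t6: "divisible_term m (u - 1) (p - 1) (q - 1) (c - 1) j b =
     zbinom (u - 2) (c - 1) * zbinom (u - c - b - 2) j * zbinom w k
     - real m * zbinom (u - 1) (c - 1) * zbinom (u - c - b - 1) j * zbinom (w - 1) (k - 1)"
    by (simp add: divisible_term_def w_def k_def algebra_simps)
  show ?thesis unfolding t1 t2 t3 t4 t5 t6 w u j by (simp add: algebra_simps)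
qed

text \<open>As for \<open>path_term\<close>, the general recurrence reduces the claim to a
  combination of terms on the line, which is the cornered term or, for \<open>b = 0\<close>,
  zero.\<close>

lemma divisible_term_corner:
  assumes m: "m > 0" and q: "0 < q"
  shows "divisible_term m (q + 1) (int m * q + 1) q c j b =
      divisible_term m (q + 1) (int m * q + 1) (q - 1) c j b
        + divisible_term m q (int m * q) (q - 1) (c - 1) j b
        + (if b = 0 then 0 else divisible_term m q (int m * q) (q - 1) c j (b - 1))"
proof -
  define p k where "p = int m * q" and "k = q - c - j - b"
  have step: "divisible_term m (q + 1) (p + 1) q c j b + divisible_term m q p (q - 1) c j b =
   divisible_term m (q + 1) (p + 1) (q - 1) c j b + divisible_term m q p q c j b
     + divisible_term m q p (q - 1) c (j - 1) b + divisible_term m q p (q - 1) (c - 1) j b"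
    using divisible_term_step[of m "q + 1" "p + 1" q c j b] by simp
  have w: "zbinom (p + 1) k = zbinom p k + zbinom p (k - 1)"
    "zbinom p (k - 1) = zbinom (p - 1) (k - 1) + zbinom (p - 1) (k - 2)"
    using zbinom_pascal[of p k] zbinom_pascal'[of p "k - 1"] by (simp_all add: algebra_simps)
  have j: "zbinom (q - c - b) j = zbinom (q - c - b - 1) j + zbinom (q - c - b - 1) (j - 1)"
    "zbinom (q - c - b - 1) j = zbinom (q - c - b - 2) j + zbinom (q - c - b - 2) (j - 1)"
    using zbinom_pascal'[of "q - c - b" j] zbinom_pascal'[of "q - c - b - 1" j] by (simp_all add: algebra_simps)
  have t1: "divisible_term m q p q c j b =
     zbinom (q - 1) c * zbinom (q - c - b - 2) j * zbinom (p + 1) k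
     - real m * zbinom q c * zbinom (q - c - b - 1) j * zbinom p (k - 1)"
    by (simp add: divisible_term_def k_def)
  have t2: "divisible_term m q p (q - 1) c j b =
     zbinom (q - 1) c * zbinom (q - c - b - 2) j * zbinom p (k - 1)
     - real m * zbinom q c * zbinom (q - c - b - 1) j * zbinom (p - 1) (k - 2)"
    by (simp add: divisible_term_def k_def algebra_simps)
  have t3: "divisible_term m q p (q - 1) c (j - 1) b =
     zbinom (q - 1) c * zbinom (q - c - b - 2) (j - 1) * zbinom p k
     - real m * zbinom q c * zbinom (q - c - b - 1) (j - 1) * zbinom (p - 1) (k - 1)"
    by (simp add: divisible_term_def k_def algebra_simps)
  have diff: "divisible_term m q p q c j b - divisible_term m q p (q - 1) c j b
     + divisible_term m q p (q - 1) c (j - 1) b =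
     zbinom (q - 1) c * zbinom (q - c - b - 1) j * zbinom p k
     - real m * zbinom q c * zbinom (q - c - b) j * zbinom (p - 1) (k - 1)"
    unfolding t1 t2 t3 w j by (simp add: algebra_simps)
  show ?thesis
  proof (cases "b = 0")
    case False
    have "divisible_term m q p (q - 1) c j (b - 1) =
       zbinom (q - 1) c * zbinom (q - c - b - 1) j * zbinom p k
       - real m * zbinom q c * zbinom (q - c - b) j * zbinom (p - 1) (k - 1)"
      by (simp add: divisible_term_def k_def algebra_simps)
    then show ?thesis
      using False step diff unfolding p_def[symmetric] by simp
  next
    case True
    have c: "of_int q * zbinom (q - 1) c = of_int (q - c) * zbinom q c"
      using zbinom_absorb_comp[of q c] by simp
    have d: "of_int (q - c) * zbinom (q - c - 1) j = of_int k * zbinom (q - c) j"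
      using zbinom_absorb_comp[of "q - c" j] True by (simp add: k_def)
    have k: "real m * of_int q * zbinom (p - 1) (k - 1) = of_int k * zbinom p k"
      using zbinom_absorb[of k p] by (simp add: p_def)
    \<comment> \<open>Three absorptions in a row pass the factor \<open>q\<close> through
      \<open>q - c\<close> and \<open>k\<close> to \<open>m q\<close>; this needs
      \<open>k = q - c - j\<close>, hence \<open>b = 0\<close>.\<close>
    have "of_int q * (zbinom (q - 1) c * zbinom (q - c - 1) j * zbinom p k) =
        of_int q * (real m * zbinom q c * zbinom (q - c) j * zbinom (p - 1) (k - 1))"
      using c d k by algebra
    then have "zbinom (q - 1) c * zbinom (q - c - 1) j * zbinom p k =
        real m * zbinom q c * zbinom (q - c) j * zbinom (p - 1) (k - 1)"
      using q by simp
    then show ?thesis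
      using True step diff unfolding p_def[symmetric] by simp
  qed
qed

section \<open>The closed forms as numbers of paths\<close>

lemma path_term_eq_0:
  assumes "c < 0 \<or> j < 0 \<or> q < c + j + b" "0 \<le> q"
  shows "path_term m p q c j b = 0"
  using assms by (auto simp: path_term_def zbinom_neg zbinom_eq_0)

text \<open>Every valley uses up a north step, so at most \<open>q\<close> valleys fit; beyond that
  the lower index \<open>q - c - j - b\<close> is negative.\<close>

lemma divisible_term_eq_0:
  assumes "c < 0 \<or> j < 0 \<or> q < c + j + b"
  shows "divisible_term m u p q c j b = 0"
  using assms by (auto simp: divisible_term_def zbinom_neg)

lemma card_paths_eq_sum_path_term:
  assumes "m > 0" "int m * q < p" "0 \<le> q" "q \<le> M" "0 \<le> b"
  shows "real (card (remaining_paths m (\<lambda>_. True) p q j b)) = (\<Sum>c=0..M. path_term m p q c j b)"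
proof (rule card_remaining_paths_eq_sum)
  show "path_term m p 0 c j b = (if c = 0 \<and> j = 0 \<and> b = 0 then 1 else 0)"
    if "0 \<le> c" "0 \<le> j" "0 \<le> b" for p c j b
    using that by (auto simp: path_term_eq_0) (auto simp: path_term_def zbinom_neg)
  show "path_term m p q c j b = 0" if "c < 0 \<or> j < 0 \<or> q < c" "0 \<le> q" "0 \<le> b" for p q c j b
    by (cases "c < 0 \<or> j < 0") (use that in \<open>auto intro!: path_term_eq_0\<close>)
qed (use assms path_term_step path_term_corner in auto)

text \<open>This decides when the parameter \<open>u\<close> drops as \<open>p\<close> decreases by
  one: exactly if \<open>m\<close> divides \<open>p - 1\<close>.\<close>

lemma div_pred:
  fixes x :: int
  assumes "m > 0"
  shows "(x - 1) div m = (if m dvd x then x div m - 1 else x div m)"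
proof (cases "m dvd x")
  case True
  then obtain k where k: "x = m * k" by blast
  have "(x - 1) div m = (m - 1 + (k - 1) * m) div m"
    by (simp add: k algebra_simps)
  also have "\<dots> = k - 1"
    using assms by (subst div_mult_self1) auto
  finally show ?thesis using True assms k by simp
next
  case False
  then have "0 < x mod m" "x mod m < m"
    using assms by (simp_all add: dvd_eq_mod_eq_0 order_le_neq_trans)
  moreover have "x - 1 = (x mod m - 1) + (x div m) * m"
    by simp
  then have "(x - 1) div m = x div m + (x mod m - 1) div m"
    using assms by (metis add.commute div_mult_self1 less_irrefl)
  ultimately show ?thesis using False by (simp add: div_pos_pos_trivial)
qed

lemma card_paths_eq_sum_divisible_term:
  assumes "m > 0" "int m * q < p" "0 \<le> q" "q \<le> M" "0 \<le> b"
  shows "real (card (remaining_paths m (\<lambda>x. int m dvd x) p q j b)) =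
    (\<Sum>c=0..M. divisible_term m ((p - 1) div int m + 1) p q c j b)"
proof (rule card_remaining_paths_eq_sum)
  let ?T = "\<lambda>p. divisible_term m ((p - 1) div int m + 1) p"
  have m: "int m > 0" using assms by simp
  show "?T p 0 c j b = (if c = 0 \<and> j = 0 \<and> b = 0 then 1 else 0)"
    if "0 \<le> c" "0 \<le> j" "0 \<le> b" for p c j b
    using that by (auto simp: divisible_term_eq_0) (auto simp: divisible_term_def zbinom_neg)
  show "?T p q c j b = 0" if "c < 0 \<or> j < 0 \<or> q < c" "0 \<le> q" "0 \<le> b" for p q c j b
    by (cases "c < 0 \<or> j < 0") (use that in \<open>auto intro!: divisible_term_eq_0\<close>)
  show "?T p q c j b + ?T (p - 1) (q - 1) c j b = ?T p (q - 1) c j b + ?T (p - 1) q c j b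
        + ?T (p - 1) (q - 1) c (j - 1) b + ?T (p - 1) (q - 1) (c - 1) j b"
    if "int m dvd p - 1" for p q c j b
    using divisible_term_step[of m "(p - 1) div int m + 1" p q c j b] div_pred[OF m, of "p - 1"] that
    by simp
  show "?T p q c j b = ?T p (q - 1) c j b + ?T (p - 1) q c j b"
    if "\<not> int m dvd p - 1" for p q c j b
    using divisible_term_pascal[of m "(p - 1) div int m + 1" p q c j b] div_pred[OF m, of "p - 1"] that
    by simp
  \<comment> \<open>The parameter \<open>u\<close> equals \<open>q + 1\<close> at
    \<open>p = m q + 1\<close> and \<open>q\<close> at \<open>p = m q\<close>.\<close>
  show "?T (int m * q + 1) q c j b =
      ?T (int m * q + 1) (q - 1) c j b + ?T (int m * q) (q - 1) (c - 1) j b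
        + (if b = 0 then 0 else ?T (int m * q) (q - 1) c j (b - 1))"
    if "0 < q" "0 \<le> b" for q c j b
    using divisible_term_corner[OF assms(1) that(1), of c j b] div_pred[OF m, of "int m * q"] m
    by simp
qed (use assms in auto)

subsection \<open>Small Schroeder paths\<close>

text \<open>With \<open>p = m n - x\<close> and \<open>q = n - y\<close>, the condition
  \<open>x \<le> m y\<close> becomes \<open>m q \<le> p\<close>; the start has level 0.\<close>

lemma small_schroeder_path_iff:
  "small_schroeder_path m t n w \<longleftrightarrow>
    remaining_path m (\<lambda>_. True) (int m * int n) (int n) w \<and> take t w = replicate t N"
  by (subst remaining_path_iff)
    (auto simp: small_schroeder_path_def right_diff_distrib)

text \<open>Since \<open>m\<close> divides \<open>m n\<close>, it divides \<open>x\<close> exactly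
  if it divides the remaining distance \<open>m n - x\<close>.\<close>

lemma divisible_schroeder_path_iff:
  "small_schroeder_path m t n w \<and> divisible_path m w \<longleftrightarrow>
    remaining_path m (\<lambda>x. int m dvd x) (int m * int n) (int n) w \<and> take t w = replicate t N"
  by (subst remaining_path_iff)
    (auto simp: small_schroeder_path_def divisible_path_def right_diff_distrib dvd_diff_right_iff)

section \<open>Diagonal and cornered steps by position\<close>

lemma card_diagonal_steps: "card (diagonal_steps w) = count_list w D"
  by (simp add: diagonal_steps_def count_list_eq_length_filter length_filter_conv_card eq_commute)

lemma card_Collect_less_Suc:
  "card {k. k < Suc l \<and> P k} = (if P 0 then 1 else 0) + card {k. k < l \<and> P (Suc k)}"
proof -
  have "{k. k < Suc l \<and> P k} = (if P 0 then {0} else {}) \<union> Suc ` {k. k < l \<and> P (Suc k)}"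
    by (auto simp: image_iff less_Suc_eq_0_disj)
  then show ?thesis
    by (simp add: card_image card_insert_if)
qed

text \<open>A suffix with remaining distances \<open>p\<close> and \<open>q\<close> starts at
  \<open>(X - p, Y - q)\<close>. Carrying this offset lets the induction pass from a path to its
  suffixes.\<close>

lemma card_corner_steps_offset:
  fixes X Y :: int
  assumes Q: "\<And>p q. 1 \<le> q \<Longrightarrow> p \<le> X \<Longrightarrow> q \<le> Y \<Longrightarrow>
    Q (X - p, Y - q) (X - p + 1, Y - q + 1) \<longleftrightarrow> p = int m * q + 1"
  shows "remaining_path m ok p q w \<Longrightarrow> p \<le> X \<Longrightarrow> q \<le> Y \<Longrightarrow>
    card {k. k < length w \<and> w ! k = D \<and>
      Q ((X - p, Y - q) + vertex w k) ((X - p, Y - q) + vertex w (Suc k))} = corner_count m p q w"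
proof (induction w arbitrary: p q)
  case Nil
  then show ?case by simp
next
  case (Cons s w)
  show ?case
  proof (cases s)
    case N
    have shift: "(X - p, Y - q) + ((0, 1) + v) = (X - p, Y - (q - 1)) + v" for v
      by (cases v) simp
    show ?thesis
      using Cons by (simp add: N card_Collect_less_Suc shift)
  next
    case E
    have shift: "(X - p, Y - q) + ((1, 0) + v) = (X - (p - 1), Y - q) + v" for v
      by (cases v) simp
    show ?thesis
      using Cons by (simp add: E card_Collect_less_Suc shift)
  next
    case D
    have shift: "(X - p, Y - q) + ((1, 1) + v) = (X - (p - 1), Y - (q - 1)) + v" for v
      by (cases v) simp
    have "1 \<le> q"
      using D Cons.prems remaining_path_bounds[of m ok "p - 1" "q - 1" w] by simp
    then have "Q (X - p, Y - q) (X - (p - 1), Y - (q - 1)) \<longleftrightarrow> p = int m * q + 1"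
      using Cons.prems Q[of q p] by (simp add: algebra_simps)
    then show ?thesis
      using Cons by (simp add: D card_Collect_less_Suc shift cong: if_cong)
  qed
qed

lemma card_cornered_steps:
  assumes "remaining_path m ok (int m * int n) (int n) w"
  shows "card (cornered_steps m n w) = corner_count m (int m * int n) (int n) w"
proof -
  let ?Q = "\<lambda>u v. \<exists>i\<in>{1..int n}. u = (i * int m - 1, i) \<and> v = (i * int m, i + 1)"
  have Q: "?Q (int m * int n - p, int n - q) (int m * int n - p + 1, int n - q + 1)
      \<longleftrightarrow> p = int m * q + 1" (is "?L \<longleftrightarrow> ?R")
    if "1 \<le> q" "p \<le> int m * int n" "q \<le> int n" for p q
  proof
    assume ?L
    then show ?R by (auto simp: algebra_simps)
  next
    assume p: ?R
    \<comment> \<open>The witness is the current height \<open>n - q\<close>; it is positive because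
      \<open>m q + 1 = p \<le> m n\<close>.\<close>
    then have "int m * (int n - q) \<ge> 1"
      using that by (simp add: right_diff_distrib)
    then have "int n - q \<ge> 1"
      using that by (cases "int n = q") auto
    then show ?L
      using p that by (intro bexI[of _ "int n - q"]) (auto simp: algebra_simps)
  qed
  show ?thesis
    using card_corner_steps_offset[where Q = ?Q, OF Q assms]
    by (simp add: cornered_steps_def diagonal_steps_def zero_prod_def[symmetric] conj_assoc)
qed

lemma remaining_path_replicate_N:
  "remaining_path m ok p q (replicate t N @ w) = remaining_path m ok p (q - int t) w"
  by (induction t arbitrary: q) (auto simp: algebra_simps)

lemma corner_count_replicate_N:
  "corner_count m p q (replicate t N @ w) = corner_count m p (q - int t) w"
  by (induction t arbitrary: q) (auto simp: algebra_simps)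

lemma count_list_replicate_N: "count_list (replicate t N @ w) D = count_list w D"
  by (induction t) auto

text \<open>Deleting the prescribed run is a bijection: north steps have no guard, contain no
  diagonal and only lower \<open>q\<close> by \<open>t\<close>. For \<open>a < b\<close> both sides
  are zero.\<close>

lemma card_initial_run:
  "card {w. remaining_path m ok (int m * int n) (int n) w \<and> take t w = replicate t N \<and>
      card (diagonal_steps w) = a \<and> card (cornered_steps m n w) = b} =
   card (remaining_paths m ok (int m * int n) (int n - int t) (int a - int b) (int b))"
proof -
  have "{w. remaining_path m ok (int m * int n) (int n) w \<and> take t w = replicate t N \<and>
      card (diagonal_steps w) = a \<and> card (cornered_steps m n w) = b} =
    (@) (replicate t N) `
      remaining_paths m ok (int m * int n) (int n - int t) (int a - int b) (int b)"
    (is "?L = _ ` ?R")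
  proof (rule set_eqI)
    fix w
    show "w \<in> ?L \<longleftrightarrow> w \<in> (@) (replicate t N) ` ?R"
    proof
      assume w: "w \<in> ?L"
      then have e: "w = replicate t N @ drop t w"
        by (metis (mono_tags, lifting) append_take_drop_id mem_Collect_eq)
      have "drop t w \<in> ?R"
        using w card_cornered_steps[of m ok n w]
          remaining_path_replicate_N[of m ok "int m * int n" "int n" t "drop t w"]
          corner_count_replicate_N[of m "int m * int n" "int n" t "drop t w"]
          count_list_replicate_N[of t "drop t w"]
        by (simp add: remaining_paths_def card_diagonal_steps flip: e)
      with e show "w \<in> (@) (replicate t N) ` ?R" by blast
    next
      assume "w \<in> (@) (replicate t N) ` ?R"
      then obtain w' where w': "w = replicate t N @ w'" "w' \<in> ?R" by blast
      have r: "remaining_path m ok (int m * int n) (int n) w"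
        using w' by (simp add: remaining_path_replicate_N remaining_paths_def)
      show "w \<in> ?L"
        using r w' card_cornered_steps[OF r]
        by (auto simp: remaining_paths_def card_diagonal_steps count_list_replicate_N
            corner_count_replicate_N)
    qed
  qed
  then show ?thesis
    by (simp add: card_image inj_on_def)
qed

text \<open>Put \<open>c = i - a - 1\<close>; the two ranges of \<open>c\<close> differ only where
  \<open>f\<close> vanishes.\<close>

lemma sum_reindex_valleys:
  fixes f :: "int \<Rightarrow> real"
  assumes zero: "\<And>c. c < 0 \<or> q < c + int a \<Longrightarrow> f c = 0" and "q \<le> M"
  shows "(\<Sum>i=1..q + 1. f (i - int a - 1)) = (\<Sum>c=0..M. f c)"
proof -
  have "(\<Sum>i=1..q + 1. f (i - int a - 1)) = sum f {- int a..q - int a}"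
    by (rule sum.reindex_bij_witness[of _ "\<lambda>c. c + int a + 1" "\<lambda>i. i - int a - 1"]) auto
  also have "\<dots> = sum f {- int a..M}"
    using assms by (intro sum.mono_neutral_left) auto
  also have "\<dots> = sum f {0..M}"
    using assms by (intro sum.mono_neutral_right) auto
  finally show ?thesis .
qed

section \<open>The closed forms as the stated summands\<close>

lemma zbinom_symmetric: "0 \<le> k \<Longrightarrow> k \<le> x \<Longrightarrow> zbinom x (x - k) = zbinom x k"
  using zbinom_of_nat[of "nat x" "nat (x - k)"] zbinom_of_nat[of "nat x" "nat k"]
    binomial_symmetric[of "nat k" "nat x"]
  by (simp add: nat_diff_distrib)

text \<open>Each binomial in \<open>path_term\<close> is one of \<open>P\<close>, \<open>Z\<close>,
  \<open>W\<close> or related to one by absorption. This leaves an identity between rational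
  coefficients of \<open>W * Z * P\<close>.\<close>

lemma path_term_closed_form:
  fixes m n t a b :: nat and i :: int
  assumes m: "m > 0" and n: "n > 0" and t: "t > 0" and i: "1 \<le> i" "i \<le> int n - int t + 1"
  shows "(ratio (real n - of_int i) (real m * real n - of_int i + real a - real b)
             * (real m * real n - of_int i + real a + 1) / real n
         - (real n - real t - of_int i + 1) / (real n - real t + 1)
         + (real b + 1) * (real m - 1) / (real m * real n - of_int i + real a - real b))
        * zbinom (int m * int n - i + int a - int b) (int a - int b)
        * zbinom (int n - int t + 1) (int n - int t - i + 1)
        * zbinom (int m * int n) (i - int a - 1)
    = path_term m (int m * int n) (int n - int t) (i - int a - 1) (int a - int b) (int b)"
proof -
  define p q c j where "p = int m * int n" and "q = int n - int t"
    and "c = i - int a - 1" and "j = int a - int b"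
  define K where "K = p - c - int b - 1"
  define P Z W where "P = zbinom p c" and "Z = zbinom K j" and "W = zbinom (q + 1) i"
  have q: "0 \<le> q" "0 < real_of_int (q + 1)" using i unfolding q_def by auto
  have ij: "i = c + j + int b + 1" by (simp add: c_def j_def)
  have W: "zbinom (int n - int t + 1) (int n - int t - i + 1) = W"
    using zbinom_symmetric[of i "q + 1"] i unfolding W_def q_def by (simp add: algebra_simps)
  have args: "int m * int n - i + int a - int b = K"
    "real m * real n - of_int i + real a - real b = of_int K"
    "real m * real n - of_int i + real a + 1 = of_int p - of_int c"
    "real n - real t - of_int i + 1 = of_int (q + 1) - of_int i"
    "real n - real t + 1 = of_int (q + 1)"
    by (simp_all add: K_def p_def c_def q_def)
  have T: "path_term m p q c j (int b) = zbinom q (i - 1) * P * Z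
      - real m * W * (zbinom (p - 1) (c - 1) * Z + zbinom (p - 1) c * zbinom (K - 1) (j - 1))"
    unfolding path_term_def P_def Z_def W_def K_def ij by (simp add: algebra_simps)
  have "(ratio (real n - of_int i) (of_int K) * (of_int p - of_int c) / real n
      - (of_int (q + 1) - of_int i) / of_int (q + 1) + (real b + 1) * (real m - 1) / of_int K)
      * Z * W * P = path_term m p q c j (int b)"
  proof (cases "c < 0 \<or> j < 0")
    case True
    then show ?thesis using q by (auto simp: path_term_eq_0 P_def Z_def zbinom_neg)
  next
    case False
    have rp: "real_of_int p = real m * real n" by (simp add: p_def)
    have a1: "zbinom q (i - 1) = of_int i * W / of_int (q + 1)"
      using zbinom_absorb[of i "q + 1"] q by (simp add: W_def field_simps)
    have a2: "real m * zbinom (p - 1) (c - 1) = of_int c * P / real n"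
      using zbinom_absorb[of c p] n by (simp add: P_def rp field_simps)
    have a3: "real m * zbinom (p - 1) c = of_int (p - c) * P / real n"
      using zbinom_absorb_comp[of p c] n by (simp add: P_def rp field_simps)
    have T': "path_term m p q c j (int b) = W * (of_int i / of_int (q + 1) * P * Z
      - (of_int c * P / real n * Z + of_int (p - c) * P / real n * zbinom (K - 1) (j - 1)))"
      unfolding T a1 a2[symmetric] a3[symmetric] by (simp add: algebra_simps)
    show ?thesis
    proof (cases "K = 0")
      case True
      \<comment> \<open>Now \<open>m n = i - j \<le> n\<close>, which forces \<open>j = 0\<close>,
        \<open>i = n\<close>, \<open>m = 1\<close> and \<open>t = 1\<close>. This is the
        \<open>0 / 0\<close> case: \<open>ratio\<close> is 1, and the last quotient is 0 because
        division by zero yields 0.\<close>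
      have "int n \<le> int m * int n"
      using m mult_right_mono[of 1 "int m" "int n"] by simp
      moreover have "int m * int n = i - j" using True by (simp add: K_def p_def ij)
      ultimately have j0: "j = 0" and i: "i = int n" and mn: "int m * int n = int n"
        using False i t by linarith+
      have m1: "m = 1" using mn n by simp
      have "q + 1 = i" using i assms(5) t by (simp add: q_def)
      then show ?thesis
        unfolding T' using j0 i m1 True n
        by (simp add: ratio_def Z_def zbinom_neg p_def field_simps)
    next
      case False
      have a4: "zbinom (K - 1) (j - 1) = of_int j * Z / of_int K"
        using zbinom_absorb[of j K] False by (simp add: Z_def field_simps)
      have r: "ratio (real n - of_int i) (of_int K) = (real n - of_int i) / of_int K"
        using False by (simp add: ratio_def)
      have K: "real_of_int K = real m * real n - of_int c - real b - 1"
        by (simp add: K_def p_def)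
      have key: "(real n - of_int i) * (of_int p - of_int c) / (of_int K * real n)
          + (real b + 1) * (real m - 1) / of_int K - 1
          = - (of_int c / real n + of_int (p - c) * of_int j / (real n * of_int K))"
      proof -
        \<comment> \<open>The identity \<open>key\<close> with denominators cleared by
          \<open>K n\<close>; it is polynomial once \<open>p = m n\<close> and
          \<open>i = c + j + b + 1\<close> are inserted.\<close>
        have "(real n - of_int i) * (of_int p - of_int c) + (real b + 1) * (real m - 1) * real n
            - of_int K * real n + of_int c * of_int K + of_int (p - c) * of_int j = 0"
          unfolding K rp ij by (simp add: rp algebra_simps)
        moreover have frac: "A / (of_int K * real n) + B / of_int K - 1
            + (x / real n + y / (real n * of_int K))
            = (A + B * real n - of_int K * real n + x * of_int K + y) / (of_int K * real n)"
          for A B x y :: real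
          using n False by (simp add: add_divide_distrib diff_divide_distrib mult.commute)
        ultimately show ?thesis unfolding eq_neg_iff_add_eq_0 frac by simp
      qed
      have "(of_int (q + 1) - of_int i) / of_int (q + 1) = 1 - real_of_int i / of_int (q + 1)"
        using q by (simp add: field_simps)
      then have coeff: "ratio (real n - of_int i) (of_int K) * (of_int p - of_int c) / real n
        - (of_int (q + 1) - of_int i) / of_int (q + 1) + (real b + 1) * (real m - 1) / of_int K
        = real_of_int i / of_int (q + 1)
          - (of_int c / real n + of_int (p - c) * of_int j / (real n * of_int K))"
        using key unfolding r by simp
      then show ?thesis
        unfolding T' a4 coeff by (simp add: algebra_simps diff_divide_distrib)
    qed
  qed
  then show ?thesis
    unfolding W args P_def Z_def p_def q_def c_def j_def .
qed

text \<open>Absorption again extracts the common product \<open>Z * W * P\<close>. The parameter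
  \<open>u\<close> is \<open>n\<close>, its value at \<open>p = m n\<close>.\<close>

lemma divisible_term_closed_form:
  fixes m n t a b :: nat and i :: int
  assumes m: "m > 0" and n: "n > 0" and t: "t > 0" and i: "1 \<le> i" "i \<le> int n - int t + 1"
  shows "(ratio (real n - of_int i) (real n - of_int i + real a - real b)
             * (real n - of_int i + real a + 1) / real n
         - real m * (real n - real t - of_int i + 1) / (real m * real n - real t + 1))
        * zbinom (int n - i + int a - int b) (int a - int b)
        * zbinom (int m * int n - int t + 1) (int n - int t - i + 1)
        * zbinom (int n) (i - int a - 1)
    = divisible_term m (int n) (int m * int n) (int n - int t) (i - int a - 1)
        (int a - int b) (int b)"
proof -
  define c j S k where "c = i - int a - 1" and "j = int a - int b"
    and "S = int m * int n - int t + 1" and "k = int n - int t - i + 1"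
  define K where "K = int n - c - int b - 1"
  define P Z W where "P = zbinom (int n) c" and "Z = zbinom K j" and "W = zbinom S k"
  have "int n \<le> int m * int n"
      using m mult_right_mono[of 1 "int m" "int n"] by simp
  then have "0 < S" using i unfolding S_def by linarith
  then have S: "0 < real_of_int S" by simp
  have args: "int n - i + int a - int b = K"
    "real n - of_int i + real a - real b = of_int K"
    "real n - of_int i + real a + 1 = real n - of_int c"
    "real n - real t - of_int i + 1 = of_int k"
    "real m * real n - real t + 1 = of_int S"
    by (simp_all add: K_def S_def c_def k_def)
  have Kj: "int n - i = K - j" by (simp add: K_def c_def j_def)
  then have Kj': "real n - of_int i = of_int (K - j)"
    by (metis of_int_diff of_int_of_nat_eq)
  have T: "divisible_term m (int n) (int m * int n) (int n - int t) c j (int b) =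
      zbinom (int n - 1) c * zbinom (K - 1) j * W - real m * P * Z * zbinom (S - 1) (k - 1)"
    unfolding divisible_term_def P_def Z_def W_def K_def S_def k_def c_def j_def
    by (simp add: algebra_simps)
  have a1: "zbinom (int n - 1) c = (real n - of_int c) * P / real n"
    using zbinom_absorb_comp[of "int n" c] n by (simp add: P_def field_simps)
  have a2: "zbinom (S - 1) (k - 1) = of_int k * W / of_int S"
    using zbinom_absorb[of k S] S by (simp add: W_def field_simps)
  have a3: "zbinom (K - 1) j = ratio (real n - of_int i) (of_int K) * Z"
  proof (cases "K = 0")
    \<comment> \<open>Since \<open>j = i - n \<le> 0\<close>, either \<open>j < 0\<close> and both
      binomials vanish, or \<open>j = 0\<close> and both are 1, in agreement with
      \<open>ratio 0 0 = 1\<close>.\<close>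
    case True
    then have "j \<le> 0" using Kj i t by simp
    then show ?thesis
      by (cases "j = 0") (use True Kj' in \<open>simp_all add: ratio_def Z_def zbinom_neg\<close>)
  next
    case False
    then show ?thesis
      using zbinom_absorb_comp[of K j] by (simp add: Z_def Kj' ratio_def field_simps)
  qed
  have "(ratio (real n - of_int i) (of_int K) * (real n - of_int c) / real n
      - real m * of_int k / of_int S) * Z * W * P =
      divisible_term m (int n) (int m * int n) (int n - int t) c j (int b)"
    unfolding T a1 a2 a3 by (simp add: algebra_simps)
  then show ?thesis
    unfolding args P_def Z_def W_def S_def k_def c_def j_def .
qed

theorem theorem1p3:
  fixes m n t a b :: nat
  assumes "m > 0" and "n > 0" and "t > 0"
  shows
    "real (card {w. small_schroeder_path m t n w \<and>
                    card (diagonal_steps w) = a \<and> card (cornered_steps m n w) = b}) =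
     (\<Sum>i = 1..int n - int t + 1.
        (ratio (real n - of_int i) (real m * real n - of_int i + real a - real b)
             * (real m * real n - of_int i + real a + 1) / real n
         - (real n - real t - of_int i + 1) / (real n - real t + 1)
         + (real b + 1) * (real m - 1) / (real m * real n - of_int i + real a - real b))
        * zbinom (int m * int n - i + int a - int b) (int a - int b)
        * zbinom (int n - int t + 1) (int n - int t - i + 1)
        * zbinom (int m * int n) (i - int a - 1))
   \<and> real (card {w. small_schroeder_path m t n w \<and> divisible_path m w \<and>
                    card (diagonal_steps w) = a \<and> card (cornered_steps m n w) = b}) =
     (\<Sum>i = 1..int n - int t + 1.
        (ratio (real n - of_int i) (real n - of_int i + real a - real b)
             * (real n - of_int i + real a + 1) / real n
         - real m * (real n - real t - of_int i + 1) / (real m * real n - real t + 1))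
        * zbinom (int n - i + int a - int b) (int a - int b)
        * zbinom (int m * int n - int t + 1) (int n - int t - i + 1)
        * zbinom (int n) (i - int a - 1))"
    (is "real (card ?X) = sum ?f ?I \<and> real (card ?Y) = sum ?g ?I")
proof -
  define q where "q = int n - int t"
  let ?p = "int m * int n"
  let ?C = "\<lambda>ok. real (card (remaining_paths m ok ?p q (int a - int b) (int b)))"
  have X: "real (card ?X) = ?C (\<lambda>_. True)"
    unfolding small_schroeder_path_iff q_def card_initial_run[symmetric] by (simp only: conj_assoc)
  have Y: "real (card ?Y) = ?C (\<lambda>x. int m dvd x)"
    unfolding conj_assoc[symmetric] divisible_schroeder_path_iff q_def card_initial_run[symmetric]
    by (simp only: conj_assoc)
  show ?thesis
  proof (cases "q < 0")
    \<comment> \<open>For \<open>t > n\<close> no path has \<open>t\<close> initial north steps, and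
      the range of summation is empty.\<close>
    case True
    then show ?thesis
      unfolding X Y by (simp add: remaining_paths_outside) (simp add: q_def)
  next
    case False
    \<comment> \<open>Because \<open>t > 0\<close>, the initial run ends strictly above the line, as
      the counting lemmas require.\<close>
    then have q: "0 \<le> q" "q \<le> int n" "int m * q < ?p"
      using assms by (simp_all add: q_def)
    have I: "?I = {1..q + 1}" by (simp add: q_def)
    have "(?p - 1) div int m + 1 = int n"
      using div_pred[of "int m" ?p] assms by simp
    then have "?C (\<lambda>x. int m dvd x) =
        (\<Sum>c=0..int n. divisible_term m (int n) ?p q c (int a - int b) (int b))"
      using card_paths_eq_sum_divisible_term[OF assms(1) q(3,1,2), of "int b"] by simp
    also have "\<dots> =
        (\<Sum>i=1..q + 1. divisible_term m (int n) ?p q (i - int a - 1) (int a - int b) (int b))"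
      using q by (intro sum_reindex_valleys[symmetric]) (auto simp: divisible_term_eq_0)
    also have "\<dots> = sum ?g {1..q + 1}"
      using assms unfolding q_def
      by (intro sum.cong[OF refl] divisible_term_closed_form[symmetric]) auto
    finally have G: "?C (\<lambda>x. int m dvd x) = sum ?g {1..q + 1}" .
    have "?C (\<lambda>_. True) = (\<Sum>c=0..int n. path_term m ?p q c (int a - int b) (int b))"
      using card_paths_eq_sum_path_term[OF assms(1) q(3,1,2), of "int b"] by simp
    also have "\<dots> = (\<Sum>i=1..q + 1. path_term m ?p q (i - int a - 1) (int a - int b) (int b))"
      using q by (intro sum_reindex_valleys[symmetric]) (auto simp: path_term_eq_0)
    also have "\<dots> = sum ?f {1..q + 1}"
      using assms unfolding q_def
      by (intro sum.cong[OF refl] path_term_closed_form[symmetric]) auto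
    finally have F: "?C (\<lambda>_. True) = sum ?f {1..q + 1}" .
    show ?thesis unfolding X Y I using F G by blast
  qed
qed

end
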